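(* As $n\to\infty$, \[ \log_2\frac{1}{\mathcal{L}(K_{\lfloor n/2\rfloor,\lceil n/2\rceil})}=\Big(\frac12-\frac1{8\ln 2}\Big)n^2+O(n\log n), \] while \[ \log_2\frac{1}{\min_G\mathcal{L}(G)}=\frac{n^2}{2}+O(n\log n), \] where the minimum is over all graphs $G$ of order $n$. Consequently \[ \frac{\mathcal{L}(K_{\lfloor n/2\rfloor,\lceil n/2\rceil})}{\min_G\mathcal{L}(G)}=2^{(1/(8\ln 2)+o(1))n^2}, \] and for every sufficiently large $n$ the minimum of $\mathcal{L}$ over graphs of order $n$ is not attained by $K_{\lfloor n/2\rfloor,\lceil n/2\rceil}$.
   Context: Graphs are finite, simple and undirected. Uniform sequential attachment process: $G_1=K_1$, and for $t\ge 2$ the random graph $G_t$ is obtained from $G_{t-1}$ (which has $t-1$ vertices) as follows: choose $k$ uniformly from $\{0,1,\dots,t-1\}$, then choose a $k$-element subset $W$ of $V(G_{t-1})$ uniformly at random, then add a new vertex adjacent to exactly the vertices of $W$; all choices are independent across steps. For a graph $G$ on $n$ vertices, its likelihood is $\mathcal{L}(G)=\Pr[G_n\cong G]$. $K_{a,b}$ is the complete bipartite graph with parts of sizes $a$ and $b$. Numerically $\frac12-\frac1{8\ln2}=0.31966\ldots$. *)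

theory Defs
  imports
    "HOL-Probability.Probability"
    "HOL-Library.Landau_Symbols"
    "Graph_Theory.Graph_Theory"
begin

text \<open>
  A finite simple undirected graph is a \<^locale>\<open>pair_graph\<close>: a finite loop-free symmetric
  digraph whose arcs are ordered pairs of vertices, an edge being a pair of opposite arcs.
  All vertices are natural numbers, which loses nothing up to isomorphism.
\<close>

definition attach_vertex ::
    "nat \<Rightarrow> nat set \<Rightarrow> nat pair_pre_digraph \<Rightarrow> nat pair_pre_digraph" where
  "attach_vertex v W G =
     \<lparr> pverts = insert v (pverts G), parcs = parcs G \<union> {v} \<times> W \<union> W \<times> {v} \<rparr>"

definition attachment_step :: "nat \<Rightarrow> nat pair_pre_digraph \<Rightarrow> nat pair_pre_digraph pmf" where
  "attachment_step t G = do {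
     k \<leftarrow> pmf_of_set {0..t - 1};
     W \<leftarrow> pmf_of_set {W. W \<subseteq> pverts G \<and> card W = k};
     return_pmf (attach_vertex t W G)
   }"

text \<open>
  The graph at time \<open>t\<close> has vertex set \<open>{1..t}\<close>. The value at time 0 is a convention;
  the process starts at time 1.
\<close>

fun attachment_process :: "nat \<Rightarrow> nat pair_pre_digraph pmf" where
  "attachment_process 0 = return_pmf \<lparr> pverts = {}, parcs = {} \<rparr>"
| "attachment_process (Suc 0) = return_pmf \<lparr> pverts = {1}, parcs = {} \<rparr>"
| "attachment_process (Suc (Suc t)) =
     attachment_process (Suc t) \<bind> attachment_step (Suc (Suc t))"

definition likelihood :: "nat pair_pre_digraph \<Rightarrow> real" where
  "likelihood G = measure_pmf.prob (attachment_process (card (pverts G)))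
     {H. digraph_iso (with_proj H) (with_proj G)}"

definition graphs_of_order :: "nat \<Rightarrow> nat pair_pre_digraph set" where
  "graphs_of_order n = {G. pair_graph G \<and> card (pverts G) = n}"

definition min_likelihood :: "nat \<Rightarrow> real" where
  "min_likelihood n = Min (likelihood ` graphs_of_order n)"

definition complete_bipartite :: "nat \<Rightarrow> nat \<Rightarrow> nat pair_pre_digraph" where
  "complete_bipartite a b =
     \<lparr> pverts = {..<a + b},
       parcs = {..<a} \<times> {a..<a + b} \<union> {a..<a + b} \<times> {..<a} \<rparr>"

lemma complete_bipartite_digraph_complete_bipartite:
  "complete_bipartite_digraph a b (with_proj (complete_bipartite a b))"
  unfolding complete_bipartite_digraph_pair_def
  by (intro conjI exI[of _ "{..<a}"] exI[of _ "{a..<a + b}"])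
     (auto simp: complete_bipartite_def)

lemma complete_bipartite_in_graphs_of_order:
  "complete_bipartite a b \<in> graphs_of_order (a + b)"
  using pair_graphI_complete_bipartite[OF complete_bipartite_digraph_complete_bipartite]
  by (simp add: graphs_of_order_def complete_bipartite_def)

lemma attachment_process_rec:
  "t \<ge> 2 \<Longrightarrow> attachment_process t = attachment_process (t - 1) \<bind> attachment_step t"
  by (cases t rule: attachment_process.cases) auto

lemma finite_set_pmf_of_subsets:
  assumes "finite V" "k \<le> card V"
  shows "set_pmf (pmf_of_set {W. W \<subseteq> V \<and> card W = k}) = {W. W \<subseteq> V \<and> card W = k}"
  using assms obtain_subset_with_card_n[of k V] by (intro set_pmf_of_set) auto

lemma set_pmf_attachment_process:
  "G \<in> set_pmf (attachment_process t) \<Longrightarrow> pair_graph G \<and> pverts G = {1..t}"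
proof (induction t arbitrary: G rule: attachment_process.induct)
  case 1
  then show ?case
    by auto (unfold_locales, auto simp: symmetric_def sym_def)
next
  case 2
  then show ?case
    by auto (unfold_locales, auto simp: symmetric_def sym_def)
next
  case (3 t)
  from "3.prems" obtain H k W where H: "H \<in> set_pmf (attachment_process (Suc t))"
    and k: "k \<le> Suc t" and W: "W \<in> set_pmf (pmf_of_set {W. W \<subseteq> pverts H \<and> card W = k})"
    and G: "G = attach_vertex (Suc (Suc t)) W H"
    by (auto simp: attachment_step_def)
  from "3.IH"[OF H] have gH: "pair_graph H" and vH: "pverts H = {1..Suc t}" by auto
  interpret pair_graph H by (rule gH)
  from W k have W: "W \<subseteq> {1..Suc t}"
    by (subst (asm) finite_set_pmf_of_subsets) (auto simp: vH)
  have v: "pverts G = {1..Suc (Suc t)}"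
    unfolding G attach_vertex_def using vH by auto
  have p: "parcs G = parcs H \<union> {Suc (Suc t)} \<times> W \<union> W \<times> {Suc (Suc t)}"
    unfolding G attach_vertex_def by auto
  have "sym (parcs H)" using sym_arcs by (simp add: symmetric_def)
  then have s: "sym (parcs G)" unfolding p by (auto simp: sym_def)
  have fW: "finite W" using W finite_subset by blast
  have "pair_graph G"
    by unfold_locales
       (use W fW s vH in \<open>auto simp: v p symmetric_def no_loops dest: in_arcsD1 in_arcsD2 no_loops'\<close>)
  with v show ?case by simp
qed

text \<open>On \<^locale>\<open>pair_graph\<close>s, \<^const>\<open>digraph_iso\<close> is the usual isomorphism of simple graphs.\<close>

lemma digraph_iso_pair_iff:
  fixes G H :: "nat pair_pre_digraph"
  assumes "pair_graph G"
  shows "digraph_iso (with_proj G) (with_proj H) \<longleftrightarrow>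
    (\<exists>f. bij_betw f (pverts G) (pverts H) \<and> parcs H = (\<lambda>(u, v). (f u, f v)) ` parcs G)"
    (is "?L \<longleftrightarrow> ?R")
proof
  interpret pair_graph G by fact
  assume ?L
  then obtain h where h: "digraph_isomorphism h" "with_proj H = app_iso h (with_proj G)"
    unfolding digraph_iso_def by blast
  have V: "pverts H = iso_verts h ` pverts G"
    using arg_cong[OF h(2), of verts] by simp
  have A: "parcs H = iso_arcs h ` parcs G"
    using arg_cong[OF h(2), of arcs] by simp
  have t: "fst = iso_tail h" and d: "snd = iso_head h"
    using arg_cong[OF h(2), of tail] arg_cong[OF h(2), of head] by simp_all
  have "iso_arcs h e = (iso_verts h (fst e), iso_verts h (snd e))" if "e \<in> parcs G" for e
    using h(1) that t[symmetric] d[symmetric] by (auto simp: digraph_isomorphism_def)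
  then have "parcs H = (\<lambda>(u, v). (iso_verts h u, iso_verts h v)) ` parcs G"
    unfolding A by (intro image_cong) (auto simp: case_prod_beta)
  moreover have "bij_betw (iso_verts h) (pverts G) (pverts H)"
    using h(1) V by (auto simp: digraph_isomorphism_def bij_betw_def)
  ultimately show ?R by blast
next
  interpret pair_graph G by fact
  assume ?R
  then obtain f where f: "bij_betw f (pverts G) (pverts H)"
    and A: "parcs H = (\<lambda>(u, v). (f u, f v)) ` parcs G" by blast
  define h where "h = \<lparr> iso_verts = f, iso_arcs = (\<lambda>(u, v). (f u, f v)),
    iso_head = snd, iso_tail = fst \<rparr>"
  have i: "inj_on f (pverts G)" using f by (simp add: bij_betw_def)
  have "inj_on (\<lambda>(u, v). (f u, f v)) (parcs G)"
    by (rule inj_onI) (auto dest: inj_onD[OF i] in_arcsD1 in_arcsD2)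
  then have "digraph_isomorphism h"
    using i wf_digraph by (auto simp: digraph_isomorphism_def h_def)
  moreover have "with_proj H = app_iso h (with_proj G)"
    using f A by (simp add: app_iso_def h_def with_proj_def bij_betw_def)
  ultimately show ?L unfolding digraph_iso_def by blast
qed

lemma likelihood_cong_iso:
  assumes "pair_graph G" "digraph_iso (with_proj G) (with_proj H)"
  shows "likelihood G = likelihood H"
proof -
  interpret G: pair_graph G by fact
  have "digraph_iso (with_proj H) (with_proj G)"
    using digraph_iso_swap[OF G.wf_digraph assms(2)] .
  then have "digraph_iso (with_proj K) (with_proj G) \<longleftrightarrow> digraph_iso (with_proj K) (with_proj H)"
    for K :: "nat pair_pre_digraph"
    using assms(2) digraph_iso_trans by blast
  moreover have "card (pverts G) = card (pverts H)"
    using assms by (auto simp: digraph_iso_pair_iff intro: bij_betw_same_card)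
  ultimately show ?thesis
    unfolding likelihood_def by simp
qed

text \<open>
  There are infinitely many graphs of order \<open>n\<close>, but only finitely many up to isomorphism,
  so the minimum defining \<^const>\<open>min_likelihood\<close> exists.
\<close>

lemma finite_likelihood_graphs_of_order: "finite (likelihood ` graphs_of_order n)"
proof (rule finite_subset)
  let ?S = "(\<lambda>A. \<lparr> pverts = {..<n}, parcs = A \<rparr>) ` Pow ({..<n} \<times> {..<n})"
  show "finite (likelihood ` ?S)" by simp
  show "likelihood ` graphs_of_order n \<subseteq> likelihood ` ?S"
  proof
    fix x assume "x \<in> likelihood ` graphs_of_order n"
    then obtain G where x: "x = likelihood G" and G: "pair_graph G" "card (pverts G) = n"
      by (auto simp: graphs_of_order_def)
    interpret pair_graph G by fact
    obtain f where f: "bij_betw f (pverts G) {..<n}"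
      using ex_bij_betw_finite_nat[of "pverts G"] G(2) by (auto simp: atLeast0LessThan)
    define H where "H = \<lparr> pverts = {..<n}, parcs = (\<lambda>(u, v). (f u, f v)) ` parcs G \<rparr>"
    have "digraph_iso (with_proj G) (with_proj H)"
      unfolding digraph_iso_pair_iff[OF G(1)] using f by (auto simp: H_def)
    then have "x = likelihood H"
      using likelihood_cong_iso[OF G(1)] x by blast
    moreover have "f u < n" if "u \<in> pverts G" for u
      using bij_betwE[OF f] that by simp
    then have "H \<in> ?S"
      unfolding H_def by (intro imageI) (auto dest: in_arcsD1 in_arcsD2)
    ultimately show "x \<in> likelihood ` ?S" by blast
  qed
qed

lemma graphs_of_order_nonempty: "graphs_of_order n \<noteq> {}"
  using complete_bipartite_in_graphs_of_order[of 0 n] by auto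

lemma min_likelihood_attained: "\<exists>G \<in> graphs_of_order n. likelihood G = min_likelihood n"
proof -
  have "min_likelihood n \<in> likelihood ` graphs_of_order n"
    unfolding min_likelihood_def
    by (rule Min_in) (simp_all add: finite_likelihood_graphs_of_order graphs_of_order_nonempty)
  then show ?thesis by auto
qed

lemma min_likelihood_le: "G \<in> graphs_of_order n \<Longrightarrow> min_likelihood n \<le> likelihood G"
  unfolding min_likelihood_def by (simp add: finite_likelihood_graphs_of_order)

end

theory Submission
  imports Defs "HOL-Real_Asymp.Real_Asymp"
begin

text \<open>
  Everything rests on one formula. A graph \<open>H\<close> on \<open>{1..n}\<close> can arise in only one way: vertex \<open>t\<close>
  must choose precisely its neighbours among the earlier vertices. If it has \<open>d\<^sub>t\<close> of them, this
  has probability \<open>1 / (t * ((t - 1) choose d\<^sub>t))\<close>, so that \<open>H\<close> has probability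
  \<open>1 / (n! * (\<Prod>t=1..n. (t - 1) choose d\<^sub>t))\<close> (\<open>pmf_attachment_process\<close>). The likelihood of \<open>G\<close>
  is the sum of these probabilities over the labelled copies of \<open>G\<close>, of which there are at least
  one and at most \<open>n!\<close>. Since \<open>log\<^sub>2 n! = O(n log n)\<close>, the logarithm of the likelihood is, within
  the precision required, that of the most probable labelled copy, and the factor \<open>n!\<close> in the
  formula can be ignored as well.

  The minimum: \<open>(t - 1) choose d \<le> 2 ^ (t - 1)\<close> shows that no likelihood is below
  \<open>2 ^ - (n choose 2) / n!\<close> (\<open>likelihood_ge\<close>). On the other hand there are \<open>2 ^ (n choose 2)\<close>
  labelled graphs. Summing the likelihood over all of them counts the probability of each labelled
  graph once for each graph isomorphic to it, at most \<open>n!\<close> times, so the sum is at most \<open>n!\<close>.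
  Hence some likelihood is at most \<open>n! / 2 ^ (n choose 2)\<close> (\<open>min_likelihood_upper\<close>).

  The complete bipartite graph with parts of sizes \<open>a \<le> b\<close>: a vertex with \<open>s\<close> predecessors is
  adjacent to those in one part and not to those in the other part, so that it has \<open>d\<close>
  back-neighbours with \<open>d \<le> b\<close> and \<open>s - d \<le> b\<close>. Binomial coefficients increase towards the middle,
  so that \<open>s choose d\<close> is at least \<open>s choose b\<close>, and at least 1 if \<open>s < b\<close>. All these lower
  bounds are attained simultaneously by the order in which the part of size \<open>b\<close> comes first.
  Up to factors of size at most \<open>n!\<close>, the likelihood is therefore the reciprocal of
  \<open>\<Prod>s=b..<a + b. s choose b\<close> (\<open>likelihood_bipartite_le\<close>, \<open>likelihood_bipartite_ge\<close>).

  The logarithm of this product is a combination of the sums \<open>\<Sum>s<m. ln s!\<close>. These are compared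
  with \<open>m\<^sup>2 / 2 * ln m - 3 / 4 * m\<^sup>2\<close> with an error of \<open>O(m ln m)\<close>. For \<open>a = b = n / 2\<close> the terms
  in \<open>n\<^sup>2 * ln n\<close> cancel and \<open>(ln 2 / 2 - 1 / 8) * n\<^sup>2\<close> remains. The last two claims follow by
  subtracting the first two, because \<open>n * ln n\<close> is of lower order than \<open>n\<^sup>2\<close>.
\<close>

section \<open>Labelled graphs\<close>

definition labelled_graphs :: "nat \<Rightarrow> nat pair_pre_digraph set" where
  "labelled_graphs n = {H. pair_graph H \<and> pverts H = {1..n}}"

definition labelled_copies :: "nat \<Rightarrow> nat pair_pre_digraph \<Rightarrow> nat pair_pre_digraph set" where
  "labelled_copies n G = {H \<in> labelled_graphs n. digraph_iso (with_proj H) (with_proj G)}"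

text \<open>
  The process only ever joins a new vertex to older ones, so the number of smaller neighbours of a
  vertex is the size of the set which that vertex chose.
\<close>
definition back_degree :: "nat pair_pre_digraph \<Rightarrow> nat \<Rightarrow> nat" where
  "back_degree H t = card {u. u < t \<and> (u, t) \<in> parcs H}"

lemma labelled_graphs_arcD:
  assumes "G \<in> labelled_graphs n" "(u, v) \<in> parcs G"
  shows "u \<in> {1..n}" "v \<in> {1..n}" "u \<noteq> v" "(v, u) \<in> parcs G"
proof -
  interpret pair_graph G using assms by (auto simp: labelled_graphs_def)
  have V: "pverts G = {1..n}" using assms by (simp add: labelled_graphs_def)
  show "u \<in> {1..n}" "v \<in> {1..n}" using in_arcsD1 in_arcsD2 assms(2) V by blast+
  show "u \<noteq> v" using assms(2) no_loops' by blast
  show "(v, u) \<in> parcs G" using assms(2) by (rule arcs_symmetric)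
qed

lemma labelled_graphsI:
  assumes "pverts G = {1..n}"
    and "\<And>u v. (u, v) \<in> parcs G \<Longrightarrow> u \<in> {1..n} \<and> v \<in> {1..n} \<and> u \<noteq> v \<and> (v, u) \<in> parcs G"
  shows "G \<in> labelled_graphs n"
proof -
  have "parcs G \<subseteq> {1..n} \<times> {1..n}" using assms(2) by auto
  then have fin: "finite (parcs G)" by (rule finite_subset) simp
  have "pair_graph G"
    using assms fin
    by unfold_locales (auto simp: symmetric_def sym_def)
  with assms(1) show ?thesis by (simp add: labelled_graphs_def)
qed

lemma finite_labelled_graphs: "finite (labelled_graphs n)"
proof (rule finite_subset)
  let ?S = "(\<lambda>A. \<lparr> pverts = {1..n}, parcs = A \<rparr>) ` Pow ({1..n} \<times> {1..n})"
  show "finite ?S" by simp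
  show "labelled_graphs n \<subseteq> ?S"
  proof
    fix H assume H: "H \<in> labelled_graphs n"
    then have "H = \<lparr> pverts = {1..n}, parcs = parcs H \<rparr>"
      by (cases H) (simp add: labelled_graphs_def)
    moreover have "parcs H \<subseteq> {1..n} \<times> {1..n}"
      using labelled_graphs_arcD[OF H] by auto
    ultimately show "H \<in> ?S" by blast
  qed
qed

lemma finite_labelled_copies: "finite (labelled_copies n G)"
  by (rule finite_subset[OF _ finite_labelled_graphs]) (auto simp: labelled_copies_def)

text \<open>
  A labelled graph remembers its history: the arcs at the newest vertex give the set it chose, and
  the arcs among the older vertices give the graph before the step.
\<close>
lemma attach_vertex_inject:
  assumes "G \<in> labelled_graphs t" "G' \<in> labelled_graphs t" "W \<subseteq> {1..t}" "W' \<subseteq> {1..t}"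
    and eq: "attach_vertex (Suc t) W G = attach_vertex (Suc t) W' G'"
  shows "G = G' \<and> W = W'"
proof -
  have arcs: "parcs G \<union> {Suc t} \<times> W \<union> W \<times> {Suc t} = parcs G' \<union> {Suc t} \<times> W' \<union> W' \<times> {Suc t}"
    using arg_cong[OF eq, of parcs] by (simp add: attach_vertex_def)
  \<comment> \<open>The chosen set and the old arcs are read off from the new arcs, uniformly for both graphs.\<close>
  have W: "X = {u. (Suc t, u) \<in> parcs K \<union> {Suc t} \<times> X \<union> X \<times> {Suc t}}"
    and G: "parcs K = (parcs K \<union> {Suc t} \<times> X \<union> X \<times> {Suc t}) \<inter> {1..t} \<times> {1..t}"
    if "K \<in> labelled_graphs t" "X \<subseteq> {1..t}" for K X
    using labelled_graphs_arcD(1,2)[OF that(1)] that(2) by fastforce+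
  have "W = W'" using W[OF assms(1,3)] W[OF assms(2,4)] arcs by simp
  moreover have "parcs G = parcs G'" using G[OF assms(1,3)] G[OF assms(2,4)] arcs by simp
  moreover have "pverts G = pverts G'" using assms(1,2) by (simp add: labelled_graphs_def)
  ultimately show ?thesis by (cases G, cases G') simp
qed

section \<open>The probability of a labelled graph\<close>
text \<open>
  The first step from the empty graph can only produce the one-vertex graph, so the recursion also
  holds where the process starts, and inductions need no separate case for a single vertex.
\<close>
lemma attachment_process_Suc:
  "attachment_process (Suc t) = attachment_process t \<bind> attachment_step (Suc t)"
proof (cases t)
  case 0
  have [simp]: "{W::nat set. W = {} \<and> card W = 0} = {{}}" by auto
  show ?thesis
    by (simp add: 0 attachment_step_def bind_return_pmf pmf_of_set_singleton attach_vertex_def)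
qed simp

text \<open>
  Distinct sets give distinct graphs, so only the size \<open>k = card W\<close> contributes, and there \<open>W\<close> is one
  of \<open>t choose k\<close> equally likely sets.
\<close>
lemma pmf_attachment_step:
  assumes G: "G \<in> labelled_graphs t" and W: "W \<subseteq> {1..t}"
  shows "pmf (attachment_step (Suc t) G) (attach_vertex (Suc t) W G)
    = 1 / (real (Suc t) * real (t choose card W))"
proof -
  define S where "S k = {W. W \<subseteq> {1..t} \<and> card W = k}" for k
  have V: "pverts G = {1..t}" using G by (simp add: labelled_graphs_def)
  have finS: "finite (S k)" for k by (simp add: S_def)
  have cardS: "card (S k) = t choose k" for k using n_subsets[of "{1..t}" k] by (simp add: S_def)
  have S_ne: "S k \<noteq> {}" if "k \<le> t" for k
    using cardS[of k] that by (auto simp flip: card_gt_0_iff)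
  have inj: "inj_on (\<lambda>W. attach_vertex (Suc t) W G) (Pow {1..t})"
    using attach_vertex_inject[OF G G] by (auto intro!: inj_onI)
  let ?attach = "\<lambda>W. attach_vertex (Suc t) W G"
  have inner: "pmf (map_pmf ?attach (pmf_of_set (S k))) (?attach W)
      = (if k = card W then 1 / real (t choose k) else 0)" if k: "k \<in> {0..t}" for k
  proof -
    have "AE X in measure_pmf (pmf_of_set (S k)). (X \<in> ?attach -` {?attach W}) = (X \<in> {W})"
      using S_ne[of k] finS[of k] k W inj_onD[OF inj] by (auto simp: AE_measure_pmf_iff S_def)
    then have "measure_pmf.prob (pmf_of_set (S k)) (?attach -` {?attach W})
        = measure_pmf.prob (pmf_of_set (S k)) {W}"
      by (rule measure_pmf.finite_measure_eq_AE) auto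
    then have "pmf (map_pmf ?attach (pmf_of_set (S k))) (?attach W) = pmf (pmf_of_set (S k)) W"
      by (simp add: pmf_map measure_pmf_single)
    also have "\<dots> = (if k = card W then 1 / real (t choose k) else 0)"
      using S_ne[of k] finS[of k] k W cardS[of k]
      by (subst pmf_of_set) (auto simp: S_def)
    finally show ?thesis .
  qed
  have cW: "card W \<in> {0..t}" using card_mono[OF _ W] by simp
  have "pmf (attachment_step (Suc t) G) (attach_vertex (Suc t) W G)
    = (\<Sum>k\<in>{0..t}. pmf (map_pmf ?attach (pmf_of_set (S k))) (?attach W)) / real (card {0..t})"
    unfolding attachment_step_def V S_def[symmetric] map_pmf_def
    by (subst pmf_bind_pmf_of_set) simp_all
  also have "\<dots> = (\<Sum>k\<in>{0..t}. if k = card W then 1 / real (t choose k) else 0) / real (Suc t)"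
    using inner by simp
  also have "\<dots> = 1 / (real (Suc t) * real (t choose card W))"
    using cW by (simp add: sum.delta mult.commute)
  finally show ?thesis .
qed

lemma set_pmf_attachment_process_labelled:
  "set_pmf (attachment_process n) \<subseteq> labelled_graphs n"
  using set_pmf_attachment_process by (auto simp: labelled_graphs_def)

text \<open>
  No other graph on \<open>{1..t}\<close> can develop into the given one, so averaging over the state at time \<open>t\<close>
  leaves a single term.
\<close>
lemma pmf_attachment_process_attach:
  assumes G: "G \<in> labelled_graphs t" and W: "W \<subseteq> {1..t}"
  shows "pmf (attachment_process (Suc t)) (attach_vertex (Suc t) W G)
    = pmf (attachment_process t) G / (real (Suc t) * real (t choose card W))"
proof -
  let ?H = "attach_vertex (Suc t) W G"
  have zero: "pmf (attachment_step (Suc t) K) ?H = 0" if K: "K \<in> labelled_graphs t" "K \<noteq> G" for K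
  proof -
    have V: "pverts K = {1..t}" using K by (simp add: labelled_graphs_def)
    have "?H \<notin> set_pmf (attachment_step (Suc t) K)"
    proof
      assume "?H \<in> set_pmf (attachment_step (Suc t) K)"
      then obtain k X where "k \<le> t" "X \<in> set_pmf (pmf_of_set {W. W \<subseteq> {1..t} \<and> card W = k})"
        "?H = attach_vertex (Suc t) X K"
        by (auto simp: attachment_step_def V)
      then have "X \<subseteq> {1..t}" "?H = attach_vertex (Suc t) X K"
        by (auto simp: finite_set_pmf_of_subsets)
      then show False using attach_vertex_inject[OF G K(1) W] K(2) by blast
    qed
    then show ?thesis by (simp add: set_pmf_iff)
  qed
  have "pmf (attachment_process (Suc t)) ?H
    = (\<integral>K. pmf (attachment_step (Suc t) K) ?H \<partial>measure_pmf (attachment_process t))"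
    by (simp only: attachment_process_Suc pmf_bind)
  also have "\<dots> = (\<Sum>K\<in>{G}. pmf (attachment_step (Suc t) K) ?H * pmf (attachment_process t) K)"
    using set_pmf_attachment_process_labelled[of t] zero
    by (intro integral_measure_pmf_real) auto
  finally show ?thesis using pmf_attachment_step[OF G W] by simp
qed

text \<open>
  Undoing the last step, for use in the induction on the number of vertices; deleting the newest
  vertex does not affect the back-degrees of the others.
\<close>
lemma labelled_graphs_SucE:
  assumes H: "H \<in> labelled_graphs (Suc t)"
  obtains G W where "G \<in> labelled_graphs t" "W \<subseteq> {1..t}" "H = attach_vertex (Suc t) W G"
    "card W = back_degree H (Suc t)" "\<And>s. s \<le> t \<Longrightarrow> back_degree G s = back_degree H s"
proof -
  define G where "G = \<lparr> pverts = {1..t}, parcs = parcs H \<inter> {1..t} \<times> {1..t} \<rparr>"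
  define W where "W = {u. u < Suc t \<and> (u, Suc t) \<in> parcs H}"
  note arc = labelled_graphs_arcD[OF H]
  have G: "G \<in> labelled_graphs t"
    by (rule labelled_graphsI) (use arc in \<open>auto simp: G_def\<close>)
  have W: "W \<subseteq> {1..t}" using arc by (fastforce simp: W_def)
  have "parcs H = parcs (attach_vertex (Suc t) W G)"
  proof (rule set_eqI)
    fix e :: "nat \<times> nat"
    obtain u v where e: "e = (u, v)" by (cases e)
    show "e \<in> parcs H \<longleftrightarrow> e \<in> parcs (attach_vertex (Suc t) W G)"
      unfolding e
      using arc[of u v] arc(4)[of v u]
      by (cases "u = Suc t"; cases "v = Suc t") (auto simp: attach_vertex_def W_def G_def le_Suc_eq)
  qed
  moreover have "pverts H = pverts (attach_vertex (Suc t) W G)"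
    using H by (simp add: labelled_graphs_def attach_vertex_def G_def atLeastAtMostSuc_conv)
  ultimately have eq: "H = attach_vertex (Suc t) W G" by (cases H) (simp add: attach_vertex_def)
  have deg: "back_degree G s = back_degree H s" if "s \<le> t" for s
  proof -
    have "(u, s) \<in> parcs G \<longleftrightarrow> (u, s) \<in> parcs H" if "u < s" for u
      using arc(1,2)[of u s] that \<open>s \<le> t\<close> by (auto simp: G_def)
    then show ?thesis unfolding back_degree_def by (metis (no_types, lifting))
  qed
  show ?thesis by (rule that[OF G W eq _ deg]) (simp_all add: back_degree_def W_def)
qed

lemma pmf_attachment_process:
  "H \<in> labelled_graphs n \<Longrightarrow>
    pmf (attachment_process n) H
      = 1 / (fact n * (\<Prod>s<n. real (s choose back_degree H (Suc s))))"
proof (induction n arbitrary: H)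
  case 0
  then have "parcs H = {}" using labelled_graphs_arcD(1)[OF 0] by fastforce
  moreover have "pverts H = {}" using 0 by (simp add: labelled_graphs_def)
  ultimately have "H = \<lparr> pverts = {}, parcs = {} \<rparr>" by (cases H) simp
  then show ?case by simp
next
  case (Suc t)
  obtain G W where G: "G \<in> labelled_graphs t" and W: "W \<subseteq> {1..t}"
    and H: "H = attach_vertex (Suc t) W G" and cW: "card W = back_degree H (Suc t)"
    and deg: "\<And>s. s \<le> t \<Longrightarrow> back_degree G s = back_degree H s"
    using labelled_graphs_SucE[OF Suc.prems] by metis
  have "(\<Prod>s<t. real (s choose back_degree G (Suc s)))
      = (\<Prod>s<t. real (s choose back_degree H (Suc s)))"
    by (intro prod.cong) (simp_all add: deg)
  then have "pmf (attachment_process (Suc t)) H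
      = 1 / (fact t * (\<Prod>s<t. real (s choose back_degree H (Suc s))))
      / (real (Suc t) * real (t choose back_degree H (Suc t)))"
    using pmf_attachment_process_attach[OF G W] Suc.IH[OF G] cW H by simp
  then show ?case by (simp add: mult_ac)
qed

lemma back_degree_le:
  assumes "H \<in> labelled_graphs n"
  shows "back_degree H (Suc s) \<le> s"
proof -
  have "{u. u < Suc s \<and> (u, Suc s) \<in> parcs H} \<subseteq> {1..s}"
    using labelled_graphs_arcD(1)[OF assms] by fastforce
  from card_mono[OF _ this] show ?thesis by (simp add: back_degree_def)
qed

section \<open>Likelihood and labelled copies\<close>
lemma likelihood_eq_sum:
  assumes "card (pverts G) = n"
  shows "likelihood G = (\<Sum>H\<in>labelled_copies n G. pmf (attachment_process n) H)"
proof -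
  let ?p = "measure_pmf (attachment_process n)"
  have "likelihood G = measure ?p {H. digraph_iso (with_proj H) (with_proj G)}"
    using assms by (simp add: likelihood_def)
  also have "\<dots> = measure ?p (labelled_copies n G)"
    by (rule measure_pmf.finite_measure_eq_AE)
      (use set_pmf_attachment_process_labelled[of n] in
        \<open>auto simp: AE_measure_pmf_iff labelled_copies_def\<close>)
  finally show ?thesis by (simp add: measure_measure_pmf_finite finite_labelled_copies)
qed

definition relabel :: "(nat \<Rightarrow> nat) \<Rightarrow> nat pair_pre_digraph \<Rightarrow> nat pair_pre_digraph" where
  "relabel f G = \<lparr> pverts = f ` pverts G, parcs = (\<lambda>(u, v). (f u, f v)) ` parcs G \<rparr>"

lemma digraph_iso_relabel:
  assumes "pair_graph G" "inj_on f (pverts G)"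
  shows "digraph_iso (with_proj G) (with_proj (relabel f G))"
  using assms by (auto simp: digraph_iso_pair_iff relabel_def bij_betw_def)

lemma digraph_iso_sym_pair:
  assumes "pair_graph G" "digraph_iso (with_proj G) (with_proj H)"
  shows "digraph_iso (with_proj H) (with_proj G)"
proof -
  interpret pair_graph G by fact
  show ?thesis using digraph_iso_swap[OF wf_digraph assms(2)] .
qed

lemma relabel_in_labelled_copies:
  assumes G: "pair_graph G" and f: "bij_betw f (pverts G) {1..n}"
  shows "relabel f G \<in> labelled_copies n G"
proof -
  interpret pair_graph G by fact
  have inj: "inj_on f (pverts G)" and im: "f ` pverts G = {1..n}" using f by (auto simp: bij_betw_def)
  have "relabel f G \<in> labelled_graphs n"
  proof (rule labelled_graphsI)
    show "pverts (relabel f G) = {1..n}" using im by (simp add: relabel_def)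
    fix x y assume "(x, y) \<in> parcs (relabel f G)"
    then obtain u v where uv: "(u, v) \<in> parcs G" and xy: "x = f u" "y = f v"
      by (auto simp: relabel_def)
    have V: "u \<in> pverts G" "v \<in> pverts G" using uv in_arcsD1 in_arcsD2 by auto
    have "u \<noteq> v" using uv no_loops' by blast
    then have "x \<noteq> y" using V xy inj_onD[OF inj] by blast
    moreover have "(y, x) \<in> parcs (relabel f G)"
      using arcs_symmetric[OF uv] xy by (force simp: relabel_def)
    ultimately show "x \<in> {1..n} \<and> y \<in> {1..n} \<and> x \<noteq> y \<and> (y, x) \<in> parcs (relabel f G)"
      using V xy im by blast
  qed
  then show ?thesis
    using digraph_iso_sym_pair[OF G digraph_iso_relabel[OF G inj]] by (simp add: labelled_copies_def)
qed

lemma labelled_copies_nonempty: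
  assumes "G \<in> graphs_of_order n"
  shows "labelled_copies n G \<noteq> {}"
proof -
  have G: "pair_graph G" and n: "card (pverts G) = n" using assms by (auto simp: graphs_of_order_def)
  interpret pair_graph G by fact
  have "finite (pverts G)" using finite_verts by simp
  then obtain f where "bij_betw f (pverts G) {1..n}"
    using n finite_same_card_bij[of "pverts G" "{1..n}"] by auto
  then show ?thesis using relabel_in_labelled_copies[OF G] by blast
qed

text \<open>
  The graphs on \<open>{1..n}\<close> isomorphic to \<open>H\<close> are the images of \<open>H\<close> under the \<open>n!\<close> permutations.
\<close>
lemma card_labelled_isomorphic_le:
  assumes H: "H \<in> labelled_graphs n"
  shows "card {K \<in> labelled_graphs n. digraph_iso (with_proj H) (with_proj K)} \<le> fact n"
proof -
  let ?P = "{p. p permutes {1..n}}"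
  have gH: "pair_graph H" and V: "pverts H = {1..n}" using H by (auto simp: labelled_graphs_def)
  have "{K \<in> labelled_graphs n. digraph_iso (with_proj H) (with_proj K)} \<subseteq> (\<lambda>p. relabel p H) ` ?P"
  proof safe
    fix K assume K: "K \<in> labelled_graphs n" and "digraph_iso (with_proj H) (with_proj K)"
    then obtain f where f: "bij_betw f {1..n} {1..n}" and A: "parcs K = (\<lambda>(u, v). (f u, f v)) ` parcs H"
      using V by (auto simp: digraph_iso_pair_iff[OF gH] labelled_graphs_def)
    \<comment> \<open>An isomorphism is arbitrary outside the vertex set; fixing all other points turns it into
      a permutation without changing the image of \<open>H\<close>.\<close>
    define p where "p x = (if x \<in> {1..n} then f x else x)" for x
    have "bij_betw p {1..n} {1..n}"
      using f by (rule bij_betw_cong[THEN iffD1, rotated]) (simp add: p_def)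
    then have p: "p permutes {1..n}" by (rule bij_imp_permutes) (simp only: p_def if_False)
    have "(\<lambda>(u, v). (p u, p v)) ` parcs H = parcs K"
      unfolding A by (intro image_cong) (use labelled_graphs_arcD(1,2)[OF H] in \<open>auto simp: p_def\<close>)
    moreover have "p ` pverts H = pverts K"
      using permutes_image[OF p] V K by (simp add: labelled_graphs_def)
    ultimately have "K = relabel p H" by (cases K) (simp add: relabel_def)
    with p show "K \<in> (\<lambda>p. relabel p H) ` ?P" by blast
  qed
  then have "card {K \<in> labelled_graphs n. digraph_iso (with_proj H) (with_proj K)} \<le> card ?P"
    by (rule surj_card_le[rotated]) (simp add: finite_permutations)
  also have "card ?P = fact n" by (rule card_permutations) simp_all
  finally show ?thesis .
qed

lemma card_labelled_copies_le: "card (labelled_copies n G) \<le> fact n"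
proof (cases "labelled_copies n G = {}")
  case False
  then obtain H where H: "H \<in> labelled_graphs n" "digraph_iso (with_proj H) (with_proj G)"
    by (auto simp: labelled_copies_def)
  have gH: "pair_graph H" using H by (simp add: labelled_graphs_def)
  have "labelled_copies n G \<subseteq> {K \<in> labelled_graphs n. digraph_iso (with_proj H) (with_proj K)}"
  proof safe
    fix K assume K: "K \<in> labelled_copies n G"
    then show KL: "K \<in> labelled_graphs n" by (simp add: labelled_copies_def)
    have gK: "pair_graph K" using KL by (simp add: labelled_graphs_def)
    have "digraph_iso (with_proj G) (with_proj K)"
      using K by (intro digraph_iso_sym_pair[OF gK]) (simp add: labelled_copies_def)
    with H(2) show "digraph_iso (with_proj H) (with_proj K)" by (rule digraph_iso_trans)
  qed
  from card_mono[OF _ this] card_labelled_isomorphic_le[OF H(1)] show ?thesis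
    using finite_labelled_graphs by (auto intro: le_trans)
qed simp

lemma likelihood_ge_pmf:
  assumes "G \<in> graphs_of_order n" "H \<in> labelled_copies n G"
  shows "pmf (attachment_process n) H \<le> likelihood G"
proof -
  have "card (pverts G) = n" using assms by (simp add: graphs_of_order_def)
  then show ?thesis using assms(2)
    by (simp add: likelihood_eq_sum finite_labelled_copies member_le_sum)
qed

text \<open>
  Replacing the sum over copies by its largest term costs a factor of at most \<open>n!\<close>.
\<close>
lemma likelihood_le_fact_times:
  assumes "G \<in> graphs_of_order n"
    and "\<And>H. H \<in> labelled_copies n G \<Longrightarrow> pmf (attachment_process n) H \<le> p"
  shows "likelihood G \<le> fact n * p"
proof -
  obtain H where "H \<in> labelled_copies n G" using labelled_copies_nonempty[OF assms(1)] by blast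
  then have p: "p \<ge> 0" by (intro order_trans[OF pmf_nonneg assms(2)])
  have "likelihood G \<le> real (card (labelled_copies n G)) * p"
    using assms by (simp add: graphs_of_order_def likelihood_eq_sum sum_bounded_above)
  also have "\<dots> \<le> real (fact n) * p"
    using card_labelled_copies_le p by (intro mult_right_mono) (simp_all only: of_nat_le_iff)
  finally show ?thesis by simp
qed

section \<open>The minimum likelihood\<close>
text \<open>
  A single labelled copy suffices: each factor \<open>s choose d\<close> of its probability is at most \<open>2 ^ s\<close>,
  and the exponents add up to \<open>n choose 2\<close>.
\<close>
lemma likelihood_ge:
  assumes "G \<in> graphs_of_order n"
  shows "1 / (fact n * 2 ^ (n choose 2)) \<le> likelihood G"
proof -
  obtain H where H: "H \<in> labelled_copies n G" using labelled_copies_nonempty[OF assms] by blast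
  then have HL: "H \<in> labelled_graphs n" by (simp add: labelled_copies_def)
  have pos: "0 < real (s choose back_degree H (Suc s))" for s
    using back_degree_le[OF HL, of s] by simp
  have "(\<Prod>s<n. real (s choose back_degree H (Suc s))) \<le> (\<Prod>s<n. 2 ^ s)"
  proof (intro prod_mono conjI)
    fix s
    have "real (s choose back_degree H (Suc s)) \<le> real (2 ^ s)"
      by (simp only: of_nat_le_iff binomial_le_pow2)
    then show "real (s choose back_degree H (Suc s)) \<le> 2 ^ s" by simp
  qed simp
  also have "\<dots> = 2 ^ (n choose 2)"
    by (simp add: power_sum[symmetric] Sum_Ico_nat lessThan_atLeast0 choose_two)
  finally have "1 / (fact n * 2 ^ (n choose 2)) \<le> pmf (attachment_process n) H"
    unfolding pmf_attachment_process[OF HL]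
    by (intro divide_left_mono mult_left_mono mult_pos_pos prod_pos) (use pos in auto)
  with likelihood_ge_pmf[OF assms H] show ?thesis by simp
qed

lemma likelihood_pos: "G \<in> graphs_of_order n \<Longrightarrow> 0 < likelihood G"
  by (rule less_le_trans[OF _ likelihood_ge]) simp_all

text \<open>
  Every set of pairs \<open>(j, i)\<close> with \<open>i < j\<close> is the edge set of a graph, different sets giving different
  graphs.
\<close>
lemma card_labelled_graphs_ge: "2 ^ (n choose 2) \<le> card (labelled_graphs n)"
proof -
  define E where "E = (SIGMA j:{1..n}. {1..<j})"
  define F :: "(nat \<times> nat) set \<Rightarrow> nat pair_pre_digraph"
    where "F S = \<lparr> pverts = {1..n}, parcs = S \<union> S\<inverse> \<rparr>" for S
  have "card E = (\<Sum>j\<in>{1..n}. j - 1)" by (simp add: E_def)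
  also have "\<dots> = (\<Sum>j<n. j)"
    by (rule sum.reindex_bij_witness[of _ Suc "\<lambda>j. j - 1"]) auto
  also have "\<dots> = n choose 2" by (simp add: lessThan_atLeast0 Sum_Ico_nat choose_two)
  finally have cE: "card E = n choose 2" .
  have "inj_on F (Pow E)"
  proof (rule inj_onI)
    fix S T assume "S \<in> Pow E" "T \<in> Pow E" and "F S = F T"
    moreover have "X = (X \<union> X\<inverse>) \<inter> E" if "X \<in> Pow E" for X
      using that by (fastforce simp: E_def)
    ultimately show "S = T" unfolding F_def by (metis pair_pre_digraph.ext_inject)
  qed
  moreover have "F ` Pow E \<subseteq> labelled_graphs n"
  proof safe
    fix S assume "S \<subseteq> E"
    then have S: "1 \<le> v \<and> v < u \<and> u \<le> n" if "(u, v) \<in> S" for u v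
      using that by (auto simp: E_def)
    show "F S \<in> labelled_graphs n"
      by (rule labelled_graphsI) (use S in \<open>fastforce simp: F_def\<close>)+
  qed
  ultimately have "card (Pow E) \<le> card (labelled_graphs n)"
    by (meson card_inj_on_le finite_labelled_graphs)
  moreover have "finite E" by (simp add: E_def)
  ultimately show ?thesis by (simp add: card_Pow cE)
qed

text \<open>
  The minimum is at most the average of the likelihood over all labelled graphs, and that average is
  computed by exchanging the order of summation over pairs of isomorphic graphs.
\<close>
lemma min_likelihood_upper: "min_likelihood n \<le> fact n / 2 ^ (n choose 2)"
proof -
  let ?L = "labelled_graphs n"
  let ?iso = "\<lambda>H G. digraph_iso (with_proj H) (with_proj G)"
  let ?p = "pmf (attachment_process n)"
  have order: "G \<in> graphs_of_order n" if "G \<in> ?L" for G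
    using that by (simp add: labelled_graphs_def graphs_of_order_def)
  have m0: "0 \<le> min_likelihood n"
    using min_likelihood_attained[of n] likelihood_pos by force
  have "real (2 ^ (n choose 2)) \<le> real (card ?L)"
    by (simp only: of_nat_le_iff card_labelled_graphs_ge)
  then have "2 ^ (n choose 2) * min_likelihood n \<le> real (card ?L) * min_likelihood n"
    using m0 by (intro mult_right_mono) simp_all
  also have "\<dots> \<le> (\<Sum>G\<in>?L. likelihood G)"
    by (rule sum_bounded_below) (rule min_likelihood_le[OF order])
  also have "\<dots> = (\<Sum>G\<in>?L. \<Sum>H\<in>{H \<in> ?L. ?iso H G}. ?p H)"
    by (intro sum.cong) (simp_all add: likelihood_eq_sum[of _ n] labelled_copies_def labelled_graphs_def)
  also have "\<dots> = (\<Sum>H\<in>?L. \<Sum>G\<in>{G \<in> ?L. ?iso H G}. ?p H)"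
    by (rule sum.swap_restrict) (rule finite_labelled_graphs)+
  also have "\<dots> = (\<Sum>H\<in>?L. real (card {G \<in> ?L. ?iso H G}) * ?p H)" by simp
  also have "\<dots> \<le> (\<Sum>H\<in>?L. fact n * ?p H)"
  proof (intro sum_mono mult_right_mono)
    fix H assume "H \<in> ?L"
    then have "real (card {G \<in> ?L. ?iso H G}) \<le> real (fact n)"
      by (simp only: of_nat_le_iff card_labelled_isomorphic_le)
    then show "real (card {G \<in> ?L. ?iso H G}) \<le> fact n" by simp
  qed simp
  also have "\<dots> = fact n"
    using sum_pmf_eq_1[OF finite_labelled_graphs set_pmf_attachment_process_labelled]
    by (simp only: sum_distrib_left[symmetric])
  finally show ?thesis by (simp add: field_simps)
qed

section \<open>The likelihood of complete bipartite graphs\<close>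
text \<open>
  The hypotheses say that \<open>d\<close> lies between \<open>s - b\<close> and \<open>b\<close>, hence no further from the middle \<open>s / 2\<close>
  than \<open>b\<close>.
\<close>
lemma binomial_balanced_ge:
  assumes "d \<le> b" "s - d \<le> b" "b \<le> s"
  shows "s choose b \<le> s choose d"
proof (cases "s \<le> 2 * d")
  case True
  then show ?thesis using assms by (intro binomial_antimono) auto
next
  case False
  have "s choose b \<le> s choose (s - d)"
    using False assms by (intro binomial_antimono) auto
  also have "\<dots> = s choose d" using assms by (intro binomial_symmetric[symmetric]) simp
  finally show ?thesis .
qed

text \<open>
  When the \<open>b\<close> vertices of one part come first, they choose the empty set, and the \<open>k\<close>-th vertex of the
  other part (counted from 0) has to choose the \<open>b\<close> vertices of the first part among its \<open>b + k\<close>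
  predecessors.
\<close>
definition bipartite_cost :: "nat \<Rightarrow> nat \<Rightarrow> real" where
  "bipartite_cost a b = (\<Prod>k<a. real ((b + k) choose b))"

lemma bipartite_cost_pos: "0 < bipartite_cost a b"
  unfolding bipartite_cost_def by (intro prod_pos) simp

lemma prod_lessThan_add:
  "(\<Prod>s<b + a. g s) = (\<Prod>s<b. g s) * (\<Prod>k<a. g (b + k))" for g :: "nat \<Rightarrow> real"
  by (induction a) (simp_all add: mult_ac)

text \<open>
  The \<open>s\<close> vertices older than a given one split into its back-neighbours and the others, and each of
  these two sets lies within one part.
\<close>
lemma back_degree_bipartite_copy:
  assumes H: "H \<in> labelled_copies (a + b) (complete_bipartite a b)" and "a \<le> b" and s: "s < a + b"
  shows "back_degree H (Suc s) \<le> b \<and> s - back_degree H (Suc s) \<le> b"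
proof -
  let ?n = "a + b"
  let ?K = "complete_bipartite a b"
  have HL: "H \<in> labelled_graphs ?n" using H by (simp add: labelled_copies_def)
  then have gH: "pair_graph H" and V: "pverts H = {1..?n}" by (auto simp: labelled_graphs_def)
  obtain f where f: "bij_betw f {1..?n} {..<?n}"
    and A: "parcs ?K = (\<lambda>(u, v). (f u, f v)) ` parcs H"
    using H V by (auto simp: labelled_copies_def digraph_iso_pair_iff[OF gH] complete_bipartite_def)
  have inj: "inj_on f {1..?n}" and im: "f ` {1..?n} = {..<?n}" using f by (auto simp: bij_betw_def)
  \<comment> \<open>\<open>X\<close> and \<open>Y\<close> are the two parts in the labelled copy.\<close>
  define X where "X = {u \<in> {1..?n}. f u < a}"
  define Y where "Y = {u \<in> {1..?n}. a \<le> f u}"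
  have arc: "(u, v) \<in> parcs H \<longleftrightarrow> (f u < a) \<noteq> (f v < a)" if uv: "u \<in> {1..?n}" "v \<in> {1..?n}" for u v
  proof -
    have "(u, v) \<in> parcs H \<longleftrightarrow> (f u, f v) \<in> parcs ?K"
    proof
      assume "(f u, f v) \<in> parcs ?K"
      then obtain u' v' where "(u', v') \<in> parcs H" "f u = f u'" "f v = f v'" unfolding A by auto
      moreover from this have "u' \<in> {1..?n}" "v' \<in> {1..?n}" using labelled_graphs_arcD(1,2)[OF HL] by blast+
      ultimately show "(u, v) \<in> parcs H" using uv inj_onD[OF inj] by metis
    qed (auto simp: A)
    moreover have "f u < ?n" "f v < ?n" using im uv by blast+
    ultimately show ?thesis by (auto simp: complete_bipartite_def)
  qed
  have "f ` X = {..<a}"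
  proof (intro equalityI subsetI)
    fix y assume "y \<in> {..<a}"
    moreover from this have "y \<in> f ` {1..?n}" unfolding im by simp
    ultimately show "y \<in> f ` X" by (auto simp: X_def)
  qed (auto simp: X_def)
  moreover have "f ` Y = {a..<?n}"
  proof (intro equalityI subsetI)
    fix y assume "y \<in> {a..<?n}"
    moreover from this have "y \<in> f ` {1..?n}" unfolding im by simp
    ultimately show "y \<in> f ` Y" by (auto simp: Y_def)
  next
    fix y assume y: "y \<in> f ` Y"
    then have "y \<in> f ` {1..?n}" by (auto simp: Y_def)
    with y show "y \<in> {a..<?n}" unfolding im by (auto simp: Y_def)
  qed
  moreover have "inj_on f X" "inj_on f Y" by (rule inj_on_subset[OF inj], force simp: X_def Y_def)+
  ultimately have cX: "card X = a" and cY: "card Y = b"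
    using card_image[of f X] card_image[of f Y] by simp_all
  have fin: "finite X" "finite Y" by (simp_all add: X_def Y_def)
  define D where "D = {u. u < Suc s \<and> (u, Suc s) \<in> parcs H}"
  have cD: "card D = back_degree H (Suc s)" by (simp add: D_def back_degree_def)
  have DS: "D \<subseteq> {1..s}" using labelled_graphs_arcD(1)[OF HL] by (fastforce simp: D_def)
  have cS: "card ({1..s} - D) = s - card D"
    using DS by (simp add: card_Diff_subset finite_subset)
  have S: "Suc s \<in> {1..?n}" using s by simp
  have mem: "u \<in> D \<longleftrightarrow> (f u < a) \<noteq> (f (Suc s) < a)" if "u \<in> {1..s}" for u
    using arc[of u "Suc s"] that s by (simp add: D_def less_Suc_eq_le)
  have side: "u \<in> X \<longleftrightarrow> f u < a" "u \<in> Y \<longleftrightarrow> \<not> f u < a" if "u \<in> {1..s}" for u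
    using that s by (simp_all add: X_def Y_def not_less)
  have "D \<subseteq> X \<and> {1..s} - D \<subseteq> Y \<or> D \<subseteq> Y \<and> {1..s} - D \<subseteq> X"
  proof (cases "f (Suc s) < a")
    case True
    then show ?thesis using mem side DS by blast
  next
    case False
    then show ?thesis using mem side DS by blast
  qed
  then have "card D \<le> b \<and> card ({1..s} - D) \<le> b"
    using card_mono[OF fin(1)] card_mono[OF fin(2)] cX cY \<open>a \<le> b\<close> by (meson le_trans order_refl)
  then show ?thesis using cS cD by simp
qed

text \<open>
  Each factor of the probability of a labelled copy is compared with the same factor for the order in
  which the part of size \<open>b\<close> comes first. The factor \<open>n!\<close> for the number of copies is compensated by
  the \<open>n!\<close> in the denominator of each probability.
\<close>
lemma likelihood_bipartite_le:
  assumes "a \<le> b"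
  shows "likelihood (complete_bipartite a b) \<le> 1 / bipartite_cost a b"
proof -
  have "likelihood (complete_bipartite a b) \<le> fact (a + b) * (1 / (fact (a + b) * bipartite_cost a b))"
  proof (rule likelihood_le_fact_times[OF complete_bipartite_in_graphs_of_order])
    fix H assume H: "H \<in> labelled_copies (a + b) (complete_bipartite a b)"
    then have HL: "H \<in> labelled_graphs (a + b)" by (simp add: labelled_copies_def)
    let ?c = "\<lambda>s. real (s choose back_degree H (Suc s))"
    have c1: "1 \<le> ?c s" for s using back_degree_le[OF HL, of s] by (simp add: Suc_leI)
    have "1 * bipartite_cost a b \<le> (\<Prod>s<b. ?c s) * (\<Prod>k<a. ?c (b + k))"
      unfolding bipartite_cost_def
    proof (intro mult_mono prod_ge_1 prod_mono conjI)
      fix k assume "k \<in> {..<a}"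
      then show "real ((b + k) choose b) \<le> ?c (b + k)"
        using back_degree_bipartite_copy[OF H \<open>a \<le> b\<close>, of "b + k"]
        by (simp only: of_nat_le_iff) (intro binomial_balanced_ge, auto)
    qed (use c1 in \<open>auto intro: prod_nonneg\<close>)
    then have "bipartite_cost a b \<le> (\<Prod>s<a + b. ?c s)"
      by (simp add: prod_lessThan_add add.commute[of a b])
    then show "pmf (attachment_process (a + b)) H \<le> 1 / (fact (a + b) * bipartite_cost a b)"
      unfolding pmf_attachment_process[OF HL] using bipartite_cost_pos[of a b]
      by (intro divide_left_mono mult_left_mono mult_pos_pos) auto
  qed
  then show ?thesis by simp
qed

text \<open>
  One copy is enough: the one in which the part of size \<open>b\<close> comes first. In the standard graph that part
  consists of the largest numbers, so reversing the order of the vertices produces it.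
\<close>
lemma likelihood_bipartite_ge:
  "1 / (fact (a + b) * bipartite_cost a b) \<le> likelihood (complete_bipartite a b)"
proof -
  let ?n = "a + b"
  let ?K = "complete_bipartite a b"
  define H where "H = relabel (\<lambda>x. ?n - x) ?K"
  have "bij_betw (\<lambda>x. ?n - x) {..<?n} {1..?n}"
    by (rule bij_betwI[where g = "\<lambda>x. ?n - x"]) auto
  then have H: "H \<in> labelled_copies ?n ?K"
    unfolding H_def using complete_bipartite_in_graphs_of_order[of a b]
    by (intro relabel_in_labelled_copies) (auto simp: graphs_of_order_def complete_bipartite_def)
  then have HL: "H \<in> labelled_graphs ?n" by (simp add: labelled_copies_def)
  have arcs: "parcs H = {b<..?n} \<times> {1..b} \<union> {1..b} \<times> {b<..?n}"
  proof -
    have A: "(\<lambda>x. ?n - x) ` {..<a} = {b<..?n}"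
    proof (intro equalityI subsetI)
      fix y assume "y \<in> {b<..?n}"
      then show "y \<in> (\<lambda>x. ?n - x) ` {..<a}" by (intro image_eqI[of _ _ "?n - y"]) auto
    qed auto
    have B: "(\<lambda>x. ?n - x) ` {a..<?n} = {1..b}"
    proof (intro equalityI subsetI)
      fix y assume "y \<in> {1..b}"
      then show "y \<in> (\<lambda>x. ?n - x) ` {a..<?n}" by (intro image_eqI[of _ _ "?n - y"]) auto
    qed auto
    have P: "(\<lambda>(u, v). (h u, h v)) ` (S \<times> T) = (h ` S) \<times> (h ` T)" for h :: "nat \<Rightarrow> nat" and S T
      by auto
    show ?thesis
      unfolding H_def relabel_def complete_bipartite_def pair_pre_digraph.simps image_Un P A B ..
  qed
  have early: "back_degree H (Suc s) = 0" if "s < b" for s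
  proof -
    have "{u. u < Suc s \<and> (u, Suc s) \<in> parcs H} = {}" using that by (auto simp: arcs)
    then show ?thesis by (simp add: back_degree_def)
  qed
  have late: "back_degree H (Suc (b + k)) = b" if "k < a" for k
  proof -
    have "{u. u < Suc (b + k) \<and> (u, Suc (b + k)) \<in> parcs H} = {1..b}" using that by (auto simp: arcs)
    then show ?thesis by (simp add: back_degree_def)
  qed
  have "(\<Prod>s<?n. real (s choose back_degree H (Suc s))) = bipartite_cost a b"
    unfolding add.commute[of a b] prod_lessThan_add by (simp add: bipartite_cost_def early late)
  then show ?thesis
    using likelihood_ge_pmf[OF complete_bipartite_in_graphs_of_order H] pmf_attachment_process[OF HL]
    by simp
qed

section \<open>Superfactorials\<close>
lemma increment_between_endpoint_derivatives:
  fixes G g :: "real \<Rightarrow> real"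
  assumes deriv: "\<And>x. 1 \<le> x \<Longrightarrow> (G has_real_derivative g x) (at x)"
    and mono: "\<And>x y. 1 \<le> x \<Longrightarrow> x \<le> y \<Longrightarrow> g x \<le> g y"
    and "1 \<le> x"
  shows "g x \<le> G (x + 1) - G x" "G (x + 1) - G x \<le> g (x + 1)"
proof -
  obtain z where "x < z" "z < x + 1" "G (x + 1) - G x = (x + 1 - x) * g z"
    using MVT2[of x "x + 1" G g] deriv \<open>1 \<le> x\<close> by auto
  then show "g x \<le> G (x + 1) - G x" "G (x + 1) - G x \<le> g (x + 1)"
    using mono[of x z] mono[of z "x + 1"] \<open>1 \<le> x\<close> by auto
qed

text \<open>
  The sums to be estimated are compared with integrals: \<open>ln n!\<close> is a sum of logarithms, so its size is
  given by an antiderivative of \<open>ln\<close>, and the sum of these is given by an antiderivative of that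
  function.
\<close>
definition ln_antideriv :: "real \<Rightarrow> real" where
  "ln_antideriv x = x * ln x - x"

definition ln_second_antideriv :: "real \<Rightarrow> real" where
  "ln_second_antideriv x = x\<^sup>2 / 2 * ln x - 3 / 4 * x\<^sup>2"

lemma ln_antideriv_increment:
  assumes "1 \<le> x"
  shows "ln x \<le> ln_antideriv (x + 1) - ln_antideriv x"
    "ln_antideriv (x + 1) - ln_antideriv x \<le> ln (x + 1)"
proof -
  have "(ln_antideriv has_real_derivative ln y) (at y)" if "1 \<le> y" for y
    unfolding ln_antideriv_def[abs_def] using that by (auto intro!: derivative_eq_intros)
  from increment_between_endpoint_derivatives[OF this, of x]
  show "ln x \<le> ln_antideriv (x + 1) - ln_antideriv x"
    "ln_antideriv (x + 1) - ln_antideriv x \<le> ln (x + 1)" using assms by auto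
qed

lemma ln_antideriv_mono:
  assumes "1 \<le> x" "x \<le> y"
  shows "ln_antideriv x \<le> ln_antideriv y"
proof (rule DERIV_nonneg_imp_nondecreasing[OF assms(2)])
  fix z assume "x \<le> z" "z \<le> y"
  then have "(ln_antideriv has_real_derivative ln z) (at z)" "0 \<le> ln z"
    unfolding ln_antideriv_def[abs_def] using assms by (auto intro!: derivative_eq_intros)
  then show "\<exists>l. (ln_antideriv has_real_derivative l) (at z) \<and> 0 \<le> l" by blast
qed

lemma ln_second_antideriv_increment:
  assumes "1 \<le> x"
  shows "ln_antideriv x \<le> ln_second_antideriv (x + 1) - ln_second_antideriv x"
    "ln_second_antideriv (x + 1) - ln_second_antideriv x \<le> ln_antideriv (x + 1)"
proof -
  have "(ln_second_antideriv has_real_derivative ln_antideriv y) (at y)" if "1 \<le> y" for y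
    unfolding ln_second_antideriv_def[abs_def] ln_antideriv_def using that
    by (auto intro!: derivative_eq_intros simp: field_simps power2_eq_square)
  from increment_between_endpoint_derivatives[OF this ln_antideriv_mono, of x]
  show "ln_antideriv x \<le> ln_second_antideriv (x + 1) - ln_second_antideriv x"
    "ln_second_antideriv (x + 1) - ln_second_antideriv x \<le> ln_antideriv (x + 1)" using assms by auto
qed

text \<open>
  A weak form of Stirling's formula. By induction, the difference between \<open>ln n!\<close> and the antiderivative
  starts at 1, never decreases, and grows in each step by at most \<open>ln (n + 1) - ln n\<close>, which telescopes.
\<close>
lemma ln_fact_bounds:
  "1 \<le> n \<Longrightarrow> ln_antideriv (real n) + 1 \<le> ln (fact n)
    \<and> ln (fact n) \<le> ln_antideriv (real n) + 1 + ln (real n)"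
proof (induction n rule: dec_induct)
  case base
  then show ?case by (simp add: ln_antideriv_def)
next
  case (step n)
  have "ln (fact (Suc n)) = ln (real n + 1) + ln (fact n)"
    by (simp add: ln_mult add.commute)
  then show ?case using step ln_antideriv_increment[of "real n"] by (simp add: add.commute)
qed

text \<open>
  The convention \<open>ln 0 = 0\<close> makes this true for \<open>n = 0\<close> as well.
\<close>
lemma ln_fact_approx: "\<bar>ln (fact n) - ln_antideriv (real n)\<bar> \<le> 1 + ln (real n)"
  using ln_fact_bounds[of n] by (cases "n = 0") (auto simp: ln_antideriv_def)

text \<open>
  In each step the difference changes by at most \<open>1 + ln (n + 1)\<close>: the increment of the antiderivative
  lies between the values of its derivative at \<open>n\<close> and \<open>n + 1\<close>, which differ by at most \<open>ln (n + 1)\<close>,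
  and \<open>ln n!\<close> exceeds the former by between 1 and \<open>1 + ln n\<close>.
\<close>
lemma sum_ln_fact_approx:
  "\<bar>(\<Sum>s<n. ln (fact s)) - ln_second_antideriv (real n)\<bar> \<le> real n * (1 + ln (real n))"
proof (induction n)
  case 0
  then show ?case by (simp add: ln_second_antideriv_def)
next
  case (Suc n)
  show ?case
  proof (cases "n = 0")
    case True
    then show ?thesis by (simp add: ln_second_antideriv_def)
  next
    case False
    then have n: "1 \<le> real n" by simp
    have "\<bar>ln (fact n) - (ln_second_antideriv (real n + 1) - ln_second_antideriv (real n))\<bar> \<le> 1 + ln (real n + 1)"
      using ln_second_antideriv_increment[OF n] ln_antideriv_increment[OF n] ln_fact_bounds[of n] n
        ln_mono[of "real n" "real n + 1"] ln_ge_zero[of "real n"] by linarith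
    moreover have "real n * ln (real n) \<le> real n * ln (real n + 1)"
      using n by (intro mult_left_mono) auto
    ultimately show ?thesis using Suc.IH by (simp add: algebra_simps abs_le_iff)
  qed
qed

section \<open>Asymptotics of the bipartite cost\<close>
lemma ln_bipartite_cost:
  "ln (bipartite_cost a b) = (\<Sum>s<a + b. ln (fact s)) - (\<Sum>s<b. ln (fact s)) - (\<Sum>s<a. ln (fact s))
     - real a * ln (fact b)"
proof (induction a)
  case (Suc a)
  have "bipartite_cost (Suc a) b = bipartite_cost a b * (fact (b + a) / (fact b * fact a))"
    by (simp add: bipartite_cost_def binomial_fact)
  moreover have "bipartite_cost a b > 0" unfolding bipartite_cost_def by (intro prod_pos) simp
  ultimately have "ln (bipartite_cost (Suc a) b)
      = ln (bipartite_cost a b) + (ln (fact (a + b)) - (ln (fact b) + ln (fact a)))"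
    by (simp add: ln_mult ln_div add.commute[of b a])
  then show ?case using Suc.IH by (simp add: algebra_simps)
qed (simp add: bipartite_cost_def)

text \<open>
  The logarithm of \<^const>\<open>bipartite_cost\<close> with all sums and factorials replaced by their
  approximations. Real arguments allow the balanced case to be written with \<open>n / 2\<close> for every \<open>n\<close>.
\<close>
definition bipartite_cost_main :: "real \<Rightarrow> real \<Rightarrow> real" where
  "bipartite_cost_main a b
    = ln_second_antideriv (a + b) - ln_second_antideriv b - ln_second_antideriv a - a * ln_antideriv b"

lemma ln_bipartite_cost_approx:
  "\<bar>ln (bipartite_cost a b) - bipartite_cost_main (real a) (real b)\<bar>
    \<le> 4 * (real (a + b) * (1 + ln (real (a + b))))"
proof -
  let ?err = "\<lambda>m. real m * (1 + ln (real m))"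
  have err_mono: "real m * (1 + ln (real k)) \<le> ?err (a + b)" if "m \<le> a + b" "k \<le> a + b" for m k
  proof (cases "a + b = 0")
    case False
    then have "ln (real k) \<le> ln (real (a + b))" using that by (cases "k = 0") auto
    moreover have "0 \<le> ln (real (a + b))" using False by (intro ln_ge_zero) linarith
    moreover have "0 \<le> ln (real k)" by (cases "k = 0") auto
    ultimately show ?thesis using that by (intro mult_mono) auto
  qed (use that in simp)
  have "\<bar>real a * (ln (fact b) - ln_antideriv (real b))\<bar> \<le> real a * (1 + ln (real b))"
    unfolding abs_mult using ln_fact_approx[of b] by (intro mult_mono) auto
  then have "\<bar>real a * ln (fact b) - real a * ln_antideriv (real b)\<bar> \<le> ?err (a + b)"
    using err_mono[of a b] by (simp add: algebra_simps)
  moreover have "\<bar>(\<Sum>s<m. ln (fact s)) - ln_second_antideriv (real m)\<bar> \<le> ?err (a + b)" if "m \<le> a + b" for m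
    using sum_ln_fact_approx[of m] err_mono[OF that that] by linarith
  from this[of "a + b"] this[of a] this[of b]
  have "\<bar>(\<Sum>s<a + b. ln (fact s)) - ln_second_antideriv (real (a + b))\<bar> \<le> ?err (a + b)"
    "\<bar>(\<Sum>s<a. ln (fact s)) - ln_second_antideriv (real a)\<bar> \<le> ?err (a + b)"
    "\<bar>(\<Sum>s<b. ln (fact s)) - ln_second_antideriv (real b)\<bar> \<le> ?err (a + b)" by auto
  ultimately show ?thesis
    unfolding ln_bipartite_cost bipartite_cost_main_def of_nat_add by linarith
qed

text \<open>
  All terms containing \<open>ln x\<close> cancel, so the main term is exactly quadratic.
\<close>
lemma bipartite_cost_main_balanced:
  assumes "0 < x"
  shows "bipartite_cost_main (x / 2) (x / 2) = (ln 2 / 2 - 1 / 8) * x\<^sup>2"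
  using assms
  by (simp add: bipartite_cost_main_def ln_antideriv_def ln_second_antideriv_def ln_div field_simps power2_eq_square)

text \<open>
  For odd \<open>n\<close> the parts are \<open>(n - 1) / 2\<close> and \<open>(n + 1) / 2\<close>. Taking the factor \<open>x / 2\<close> out of the
  logarithms exhibits the same cancellation; only logarithms close to 0, of order \<open>1 / x\<close>, survive, with
  quadratic coefficients.
\<close>
lemma bipartite_cost_main_shifted:
  assumes "1 < x"
  shows "bipartite_cost_main ((x - 1) / 2) ((x + 1) / 2) - (ln 2 / 2 - 1 / 8) * x\<^sup>2
    = 1 / 8 - (x + 1) * (3 * x - 1) / 8 * ln (1 + 1 / x) - (x - 1)\<^sup>2 / 8 * ln (1 - 1 / x)"
proof -
  have pos: "0 < x" "0 < 1 + 1 / x" "0 < 1 - 1 / x" using assms by (simp_all add: field_simps)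
  have "x + 1 = x * (1 + 1 / x)" "x - 1 = x * (1 - 1 / x)"
    using assms by (simp_all add: field_simps)
  then have "ln (x + 1) = ln x + ln (1 + 1 / x)" "ln (x - 1) = ln x + ln (1 - 1 / x)"
    using pos by (metis ln_mult_pos)+
  then have lns: "ln ((x + 1) / 2) = ln x + ln (1 + 1 / x) - ln 2"
    "ln ((x - 1) / 2) = ln x + ln (1 - 1 / x) - ln 2"
    using assms by (simp_all add: ln_div)
  have s: "(x - 1) / 2 + (x + 1) / 2 = x" by (simp add: field_simps)
  show ?thesis
    unfolding bipartite_cost_main_def ln_antideriv_def ln_second_antideriv_def s lns
    by (simp add: field_simps power2_eq_square)
qed

lemma bipartite_cost_main_odd:
  "(\<lambda>n::nat. bipartite_cost_main ((real n - 1) / 2) ((real n + 1) / 2)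
      - (ln 2 / 2 - 1 / 8) * (real n)\<^sup>2)
    \<in> O(\<lambda>n. real n * ln (real n))"
proof -
  have "\<forall>\<^sub>F n in sequentially.
      bipartite_cost_main ((real n - 1) / 2) ((real n + 1) / 2) - (ln 2 / 2 - 1 / 8) * (real n)\<^sup>2
      = 1 / 8 - (real n + 1) * (3 * real n - 1) / 8 * ln (1 + 1 / real n)
        - (real n - 1)\<^sup>2 / 8 * ln (1 - 1 / real n)"
    using eventually_gt_at_top[of 1] by eventually_elim (rule bipartite_cost_main_shifted, simp)
  moreover have "(\<lambda>n::nat. 1 / 8 - (real n + 1) * (3 * real n - 1) / 8 * ln (1 + 1 / real n)
        - (real n - 1)\<^sup>2 / 8 * ln (1 - 1 / real n)) \<in> O(\<lambda>n. real n * ln (real n))"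
    by real_asymp
  ultimately show ?thesis by (simp only: landau_o.big.in_cong)
qed

section \<open>The two asymptotic formulas\<close>
lemma ln_fact_le: "ln (fact n) \<le> real n * ln (real n)"
proof (cases "n = 0")
  case False
  have "(fact n :: real) \<le> real n ^ n" using fact_le_power[of n, where ?'a = real] by simp
  then have "ln (fact n) \<le> ln (real n ^ n)" by (intro ln_mono) auto
  then show ?thesis using False by (simp add: ln_realpow)
qed simp

lemma ln_inverse_likelihood_bipartite:
  assumes "a \<le> b"
  shows "ln (bipartite_cost a b) \<le> ln (1 / likelihood (complete_bipartite a b))"
    and "ln (1 / likelihood (complete_bipartite a b))
      \<le> ln (bipartite_cost a b) + real (a + b) * ln (real (a + b))"
proof -
  let ?l = "likelihood (complete_bipartite a b)"
  have pos: "0 < ?l" "0 < bipartite_cost a b"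
    using likelihood_pos[OF complete_bipartite_in_graphs_of_order] bipartite_cost_pos by auto
  have "bipartite_cost a b \<le> 1 / ?l"
    using likelihood_bipartite_le[OF assms] pos by (simp add: field_simps)
  then show "ln (bipartite_cost a b) \<le> ln (1 / ?l)" using pos by (intro ln_mono) auto
  have "1 / ?l \<le> fact (a + b) * bipartite_cost a b"
    using likelihood_bipartite_ge[of a b] pos by (simp add: field_simps)
  then have "ln (1 / ?l) \<le> ln (fact (a + b) * bipartite_cost a b)" using pos by (intro ln_mono) auto
  also have "\<dots> = ln (fact (a + b)) + ln (bipartite_cost a b)"
    using pos by (intro ln_mult_pos) auto
  finally show "ln (1 / ?l) \<le> ln (bipartite_cost a b) + real (a + b) * ln (real (a + b))"
    using ln_fact_le[of "a + b"] by linarith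
qed

text \<open>
  The error has three sources: Stirling-type approximation, the number of labelled copies, and the
  difference of 1 between the two parts when \<open>n\<close> is odd.
\<close>
lemma log_inverse_likelihood_balanced_bipartite:
  "(\<lambda>n. log 2 (1 / likelihood (complete_bipartite (n div 2) ((n + 1) div 2)))
      - (1 / 2 - 1 / (8 * ln 2)) * real n ^ 2) \<in> O(\<lambda>n. real n * ln (real n))"
    (is "?f \<in> _")
proof -
  \<comment> \<open>The main term for odd \<open>n\<close>; adding it for even \<open>n\<close> too gives one bound that covers both parities.\<close>
  define odd_err where "odd_err n = bipartite_cost_main ((real n - 1) / 2) ((real n + 1) / 2)
    - (ln 2 / 2 - 1 / 8) * (real n)\<^sup>2" for n
  define B where
    "B n = (4 * (real n * (1 + ln (real n))) + real n * ln (real n) + \<bar>odd_err n\<bar>) / ln 2" for n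
  have bound: "norm (?f n) \<le> B n" if "1 \<le> n" for n
  proof -
    define a b where "a = n div 2" and "b = (n + 1) div 2"
    have ab: "a \<le> b" "a + b = n" by (auto simp: a_def b_def)
    have main: "\<bar>bipartite_cost_main (real a) (real b) - (ln 2 / 2 - 1 / 8) * (real n)\<^sup>2\<bar> \<le> \<bar>odd_err n\<bar>"
    proof (cases "even n")
      case True
      then have ab2: "real a = real n / 2" "real b = real n / 2" by (auto simp: a_def b_def elim!: evenE)
      show ?thesis unfolding ab2 using bipartite_cost_main_balanced[of "real n"] that by simp
    next
      case False
      then have ab2: "real a = (real n - 1) / 2" "real b = (real n + 1) / 2"
        by (auto simp: a_def b_def elim!: oddE)
      show ?thesis unfolding ab2 odd_err_def by (rule order_refl)
    qed
    let ?L = "ln (1 / likelihood (complete_bipartite a b))"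
    have "0 \<le> real n * ln (real n)" using that by simp
    then have "\<bar>?L - (ln 2 / 2 - 1 / 8) * (real n)\<^sup>2\<bar> \<le> B n * ln 2"
      using main ln_inverse_likelihood_bipartite[OF ab(1)] ln_bipartite_cost_approx[of a b]
      unfolding ab(2) B_def by simp
    moreover have "?f n = (?L - (ln 2 / 2 - 1 / 8) * (real n)\<^sup>2) / ln 2"
      unfolding a_def b_def log_def by (simp add: field_simps)
    ultimately show ?thesis by (simp add: abs_divide divide_le_eq)
  qed
  have odd: "(\<lambda>n. \<bar>odd_err n\<bar>) \<in> O(\<lambda>n. real n * ln (real n))"
    using bipartite_cost_main_odd by (simp add: odd_err_def)
  have "(\<lambda>n. 4 * (real n * (1 + ln (real n))) + real n * ln (real n)) \<in> O(\<lambda>n. real n * ln (real n))"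
    by real_asymp
  from sum_in_bigo(1)[OF this odd] have "B \<in> O(\<lambda>n. real n * ln (real n))"
    unfolding B_def[abs_def] by simp
  moreover have "?f \<in> O(B)"
    by (rule landau_o.big_mono)
      (use eventually_ge_at_top[of 1] in eventually_elim, use bound in force)
  ultimately show ?thesis by (rule landau_o.big_trans[rotated])
qed

lemma log_inverse_min_likelihood:
  "(\<lambda>n. log 2 (1 / min_likelihood n) - real n ^ 2 / 2) \<in> O(\<lambda>n. real n * ln (real n))"
    (is "?f \<in> _")
proof -
  define B where "B n = real n / 2 + real n * ln (real n) / ln 2" for n
  have bound: "norm (?f n) \<le> B n" for n
  proof -
    let ?m = "min_likelihood n"
    have pos: "0 < ?m" using min_likelihood_attained[of n] likelihood_pos by force
    have lower: "1 / (fact n * 2 ^ (n choose 2)) \<le> ?m"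
      using min_likelihood_attained[of n] likelihood_ge by force
    have "1 / ?m \<le> fact n * 2 ^ (n choose 2)" using lower pos by (simp add: field_simps)
    then have "log 2 (1 / ?m) \<le> log 2 (fact n * 2 ^ (n choose 2))" using pos by (intro log_mono) auto
    also have "\<dots> = log 2 (fact n) + real (n choose 2)" by (simp add: log_mult log_nat_power)
    finally have up: "log 2 (1 / ?m) \<le> log 2 (fact n) + real (n choose 2)" .
    have "2 ^ (n choose 2) / fact n \<le> 1 / ?m" using min_likelihood_upper[of n] pos by (simp add: field_simps)
    then have "log 2 (2 ^ (n choose 2) / fact n) \<le> log 2 (1 / ?m)" using pos by (intro log_mono) auto
    then have low: "real (n choose 2) - log 2 (fact n) \<le> log 2 (1 / ?m)"
      by (simp add: log_divide log_nat_power)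
    have choose: "real (n choose 2) = (real n)\<^sup>2 / 2 - real n / 2"
    proof -
      have "even (n * (n - 1))" by (cases n) auto
      then have "2 * (n choose 2) = n * (n - 1)"
        unfolding choose_two by (rule dvd_mult_div_cancel)
      then have "2 * real (n choose 2) = real n * real (n - 1)" by (metis of_nat_mult of_nat_numeral)
      then show ?thesis by (cases n) (simp_all add: power2_eq_square field_simps)
    qed
    have "log 2 (fact n) \<le> real n * ln (real n) / ln 2"
      unfolding log_def using ln_fact_le[of n] by (simp add: divide_right_mono)
    then show ?thesis using up low unfolding choose B_def by (auto simp: abs_le_iff)
  qed
  have "?f \<in> O(B)"
    by (intro landau_o.big_mono always_eventually allI order_trans[OF bound]) simp
  moreover have "B \<in> O(\<lambda>n. real n * ln (real n))" unfolding B_def[abs_def] by real_asymp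
  ultimately show ?thesis by (rule landau_o.big_trans)
qed

theorem theorem6:
  shows "(\<lambda>n. log 2 (1 / likelihood (complete_bipartite (n div 2) ((n + 1) div 2)))
              - (1 / 2 - 1 / (8 * ln 2)) * real n ^ 2) \<in> O(\<lambda>n. real n * ln (real n))
    \<and> (\<lambda>n. log 2 (1 / min_likelihood n) - real n ^ 2 / 2) \<in> O(\<lambda>n. real n * ln (real n))
    \<and> (\<exists>\<epsilon> :: nat \<Rightarrow> real. \<epsilon> \<longlonglongrightarrow> 0 \<and>
          (\<forall>\<^sub>F n in sequentially.
             likelihood (complete_bipartite (n div 2) ((n + 1) div 2)) / min_likelihood n
             = 2 powr ((1 / (8 * ln 2) + \<epsilon> n) * real n ^ 2)))
    \<and> (\<forall>\<^sub>F n in sequentially.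
          likelihood (complete_bipartite (n div 2) ((n + 1) div 2)) \<noteq> min_likelihood n)"
proof -
  define l where "l n = likelihood (complete_bipartite (n div 2) ((n + 1) div 2))" for n
  define f where "f n = log 2 (1 / l n) - (1 / 2 - 1 / (8 * ln 2)) * real n ^ 2" for n
  define g where "g n = log 2 (1 / min_likelihood n) - real n ^ 2 / 2" for n
  \<comment> \<open>The main terms of the two logarithms differ by \<open>n\<^sup>2 / (8 ln 2)\<close>, so what is left over is the
    difference of their error terms.\<close>
  define \<epsilon> where "\<epsilon> n = (g n - f n) / real n ^ 2" for n
  have f: "f \<in> O(\<lambda>n. real n * ln (real n))"
    unfolding f_def[abs_def] l_def by (rule log_inverse_likelihood_balanced_bipartite)
  have g: "g \<in> O(\<lambda>n. real n * ln (real n))"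
    unfolding g_def[abs_def] by (rule log_inverse_min_likelihood)
  have "(\<lambda>n. g n - f n) \<in> O(\<lambda>n. real n * ln (real n))" using g f by (rule sum_in_bigo)
  also have "(\<lambda>n. real n * ln (real n)) \<in> o(\<lambda>n. real n ^ 2)" by real_asymp
  finally have lim: "\<epsilon> \<longlonglongrightarrow> 0" unfolding \<epsilon>_def[abs_def] by (rule smalloD_tendsto)
  have lpos: "0 < l n" for n
    unfolding l_def by (rule likelihood_pos[OF complete_bipartite_in_graphs_of_order])
  have mpos: "0 < min_likelihood n" for n using min_likelihood_attained[of n] likelihood_pos by force
  have ratio: "l n / min_likelihood n = 2 powr ((1 / (8 * ln 2) + \<epsilon> n) * real n ^ 2)" if "1 \<le> n" for n
  proof -
    have "log 2 (l n / min_likelihood n) = (1 / (8 * ln 2)) * real n ^ 2 + (g n - f n)"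
      using lpos[of n] mpos[of n] by (simp add: f_def g_def log_divide algebra_simps)
    also have "\<dots> = (1 / (8 * ln 2) + \<epsilon> n) * real n ^ 2"
      using that by (simp add: \<epsilon>_def distrib_right)
    finally show ?thesis using lpos[of n] mpos[of n] powr_log_cancel[of 2 "l n / min_likelihood n"] by simp
  qed
  have "\<forall>\<^sub>F n in sequentially. - (1 / (8 * ln 2)) < \<epsilon> n"
    by (rule order_tendstoD(1)[OF lim]) simp
  then have ne: "\<forall>\<^sub>F n in sequentially. l n \<noteq> min_likelihood n"
    using eventually_ge_at_top[of 1]
  proof eventually_elim
    case (elim n)
    then have "0 < (1 / (8 * ln 2) + \<epsilon> n) * real n ^ 2" by (intro mult_pos_pos) auto
    then have "1 < l n / min_likelihood n" unfolding ratio[OF elim(2)] by (intro gr_one_powr) auto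
    then show ?case using mpos[of n] by auto
  qed
  have "\<forall>\<^sub>F n in sequentially. l n / min_likelihood n = 2 powr ((1 / (8 * ln 2) + \<epsilon> n) * real n ^ 2)"
    using eventually_ge_at_top[of 1] by eventually_elim (rule ratio)
  then show ?thesis using f g lim ne unfolding f_def g_def l_def by blast
qed

end
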